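(* Let $n\ge 3$, let $C_n^{(1)}=\{\sigma\in S_n : |\mathbf{PSB}^{-1}(\sigma)|=1\}$ and $c_n^{(1)}=|C_n^{(1)}|$. Then $C_n^{(1)}$ consists of all permutations of size $n$ ending with $n$ whose left-to-right maxima are consecutive (in value) and pairwise nonadjacent (in position). That is, $C_n^{(1)}$ is the set of all $\pi=\pi_1\cdots\pi_n\in S_n$ such that $\pi_n=n$, there exists $k\ge 0$ with $LTR(\pi)=\{n-k,\dots,n\}$, and for all $\pi_i,\pi_j\in LTR(\pi)$ with $\pi_i\ne\pi_j$ we have $|j-i|>1$. Moreover, $$c_n^{(1)}=\sum_{k=2}^{\lceil n/2\rceil}(n-k)!\binom{n-k-1}{k-2}.$$
   Context: $S_n$ is the set of permutations of $\{1,\dots,n\}$ in one-line notation. A left-to-right maximum of a permutation is an entry larger than all entries to its left; $LTR(\pi)$ is the set of (values of) left-to-right maxima of $\pi$. For $\sigma\in S_n$, $\mathbf{PSB}^{-1}(\sigma)=\{\pi\in S_n : \mathbf{PSB}(\pi)=\sigma\}$. The map $\mathbf{PSB}$: given an input permutation $\pi=\pi_1\cdots\pi_n$, a pop stack $S$ (initially empty) is used. For $i=1,\dots,n$ in order: (1) if $S$ is empty or $\pi_i=\mathrm{TOP}(S)-1$, where $\mathrm{TOP}(S)$ is the current top element of $S$, push $\pi_i$ on top of $S$; (2) else if $\pi_i<\mathrm{TOP}(S)-1$, bypass: append $\pi_i$ directly to the right end of the output; (3) else pop, i.e. remove all elements of $S$, appending them to the output from top to bottom, and then push $\pi_i$ into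 $S$. After the last entry has been processed, pop $S$ once more. The resulting output is the permutation $\mathbf{PSB}(\pi)$. *)

theory Defs
  imports Complex_Main "HOL-Combinatorics.Multiset_Permutations"
begin

text \<open>
  A permutation of size \<open>n\<close> in one-line notation is an element of \<open>permutations_of_set {1..n}\<close>,
  the lists that contain each of \<open>1, \<dots>, n\<close> exactly once. The entry \<open>\<pi> ! i\<close> is the entry at
  position \<open>i + 1\<close>, as list positions start from 0.
\<close>

definition perms :: "nat \<Rightarrow> nat list set" where
  "perms n = permutations_of_set {1..n}"

definition LTR :: "nat list \<Rightarrow> nat set" where
  "LTR \<pi> = {\<pi> ! i | i. i < length \<pi> \<and> (\<forall>j<i. \<pi> ! j < \<pi> ! i)}"

text \<open>
  \<open>psb_run S out xs\<close> processes the remaining input \<open>xs\<close> with pop stack \<open>S\<close> (top first) and the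
  output \<open>out\<close> produced so far. The comparisons with \<open>t - 1\<close> for the top element \<open>t\<close> are written
  with \<open>x + 1\<close> and \<open>t\<close> to avoid truncated subtraction.
\<close>

fun psb_run :: "nat list \<Rightarrow> nat list \<Rightarrow> nat list \<Rightarrow> nat list" where
  "psb_run S out [] = out @ S"
| "psb_run [] out (x # xs) = psb_run [x] out xs"
| "psb_run (t # S) out (x # xs) =
     (if x + 1 = t then psb_run (x # t # S) out xs
      else if x + 1 < t then psb_run (t # S) (out @ [x]) xs
      else psb_run [x] (out @ t # S) xs)"

definition PSB :: "nat list \<Rightarrow> nat list" where
  "PSB \<pi> = psb_run [] [] \<pi>"

definition PSB_preimage :: "nat \<Rightarrow> nat list \<Rightarrow> nat list set" where
  "PSB_preimage n \<sigma> = {\<pi> \<in> perms n. PSB \<pi> = \<sigma>}"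

definition C1 :: "nat \<Rightarrow> nat list set" where
  "C1 n = {\<sigma> \<in> perms n. card (PSB_preimage n \<sigma>) = 1}"

definition c1 :: "nat \<Rightarrow> nat" where
  "c1 n = card (C1 n)"

end

theory Submission
  imports Defs
begin

text \<open>
  The stack is popped exactly when a new left-to-right maximum \<open>m\<close> arrives, so
  \<open>PSB (\<alpha> m \<beta>) = PSB \<alpha> @ psb_run [m] [] \<beta>\<close> whenever \<open>m\<close> is the largest entry. Let a permutation
  end with its maximum \<open>m\<close> and write it as \<open>us y vs m\<close> with \<open>y\<close> the second largest entry. A preimage
  \<open>q\<close> of \<open>us y\<close> gives the preimage \<open>q m vs\<close>. If \<open>m \<noteq> y + 1\<close> or \<open>vs\<close> is empty, then \<open>m us y vs\<close> is
  another one; otherwise \<open>y\<close> cannot be processed while \<open>m\<close> is on the stack, since it would be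
  output next to \<open>m\<close>, and every preimage is of the form \<open>q m vs\<close>. This gives the characterisation by
  induction. For the enumeration, let \<open>f\<close> be the first entry: the entries below \<open>f\<close> may be ordered
  arbitrarily, and \<open>f + 1, \<dots>, n - 1\<close> are inserted increasingly into distinct inner gaps between
  them.
\<close>

section \<open>Runs of the pop stack around a maximum\<close>

lemma psb_run_out: "psb_run S out xs = out @ psb_run S [] xs"
proof (induction xs arbitrary: S out)
  case (Cons x xs)
  have *: "psb_run S' (u @ v) xs = u @ psb_run S' v xs" for S' u v
    using Cons[of S' "u @ v"] Cons[of S' v] by simp
  show ?case
  proof (cases S)
    case Nil
    then show ?thesis using Cons[of "[x]" out] by simp
  next
    case (Cons t S')
    then show ?thesis using *[of _ out "[]"] *[of _ out] by simp
  qed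
qed simp

lemma mset_psb_run: "mset (psb_run S out xs) = mset S + mset out + mset xs"
  by (induction S out xs rule: psb_run.induct) auto

lemma mset_PSB: "mset (PSB xs) = mset xs"
  by (simp add: PSB_def mset_psb_run)

lemma set_PSB: "set (PSB xs) = set xs"
  by (metis mset_PSB set_mset_mset)

lemma distinct_PSB: "distinct (PSB xs) \<longleftrightarrow> distinct xs"
  by (metis mset_PSB mset_eq_imp_distinct_iff)

text \<open>Whatever is on the stack when \<open>m\<close> arrives is smaller than \<open>m\<close>,
  so \<open>m\<close> flushes it and the run restarts with \<open>[m]\<close> alone.\<close>

lemma psb_run_append_greater:
  assumes "\<forall>z\<in>set S \<union> set xs. z < m"
  shows "psb_run S out (xs @ m # ys) = psb_run S out xs @ psb_run [m] [] ys"
  using assms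
proof (induction S out xs rule: psb_run.induct)
  case (1 S out)
  then have "psb_run S out (m # ys) = psb_run [m] (out @ S) ys" by (cases S) auto
  then show ?case using psb_run_out[of "[m]" "out @ S" ys] by simp
qed auto

lemma PSB_append_greater:
  assumes "\<forall>z\<in>set xs. z < m"
  shows "PSB (xs @ m # ys) = PSB xs @ psb_run [m] [] ys"
  unfolding PSB_def by (rule psb_run_append_greater) (use assms in auto)

lemma psb_run_bypass_append:
  assumes "\<forall>x\<in>set xs. x + 1 < t"
  shows "psb_run (t # S) out (xs @ ys) = psb_run (t # S) (out @ xs) ys"
  using assms by (induction xs arbitrary: out) auto

lemma psb_run_bypass:
  assumes "\<forall>x\<in>set xs. x + 1 < t"
  shows "psb_run (t # S) out xs = out @ xs @ t # S"
  using psb_run_bypass_append[OF assms, of S out "[]"] by simp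

text \<open>Pushing \<open>x = t - 1\<close> makes \<open>x\<close> the top, and by distinctness all
  remaining entries are below \<open>x\<close>. The hypothesis survives with the new top, so nothing
  triggers a pop before the end.\<close>

lemma psb_run_keeps_stack:
  assumes "distinct xs" "\<forall>x\<in>set xs. x < t"
  shows "\<exists>ys. psb_run (t # S) out xs = ys @ t # S"
  using assms
proof (induction xs arbitrary: t S out)
  case (Cons x xs)
  show ?case
  proof (cases "x + 1 = t")
    case True
    then have "\<forall>z\<in>set xs. z < x" using Cons.prems by (auto simp: less_Suc_eq)
    then obtain ys where "psb_run (x # t # S) out xs = ys @ x # t # S"
      using Cons.IH[of x "t # S" out] Cons.prems(1) by auto
    then show ?thesis using True by (intro exI[of _ "ys @ [x]"]) simp
  next
    case False
    then show ?thesis using Cons by auto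
  qed
qed simp

text \<open>Entries before \<open>t\<close> are too small to be pushed on \<open>Suc t\<close>, so
  \<open>t\<close> lands directly on it; what follows cannot force a pop.\<close>

lemma psb_run_pushes_pred:
  assumes "distinct xs" "\<forall>x\<in>set xs. x < Suc t" "t \<in> set xs"
  shows "\<exists>ys. psb_run [Suc t] [] xs = ys @ [t, Suc t]"
proof -
  obtain us vs where xs: "xs = us @ t # vs" using assms(3) by (meson split_list)
  have "\<forall>u\<in>set us. u < t" "\<forall>v\<in>set vs. v < t"
    using assms(1,2) unfolding xs by (auto simp: less_Suc_eq)
  moreover have "distinct vs" using assms(1) xs by simp
  ultimately show ?thesis
    using psb_run_keeps_stack[of vs t "[Suc t]" us] by (simp add: xs psb_run_bypass_append)
qed

lemma split_list_at_max:
  fixes xs :: "'a::linorder list"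
  assumes "xs \<noteq> []" "distinct xs"
  obtains us m vs where "xs = us @ m # vs" "\<forall>z\<in>set us. z < m" "\<forall>z\<in>set vs. z < m"
proof -
  define m where "m = Max (set xs)"
  have "m \<in> set xs" using assms(1) by (simp add: m_def)
  then obtain us vs where xs: "xs = us @ m # vs" by (meson split_list)
  have "z < m" if "z \<in> set us \<union> set vs" for z
  proof -
    have "z \<in> set xs" "z \<noteq> m" using assms(2) that xs by auto
    then show ?thesis by (simp add: m_def order_less_le)
  qed
  then show thesis using that xs by blast
qed

text \<open>The maximum stays at the bottom of the stack from its arrival until the final
  pop.\<close>

lemma PSB_ends_with_max:
  assumes "xs \<noteq> []" "distinct xs"
  obtains ys m where "PSB xs = ys @ [m]" "\<forall>z\<in>set ys. z < m"
proof -
  obtain us m vs where xs: "xs = us @ m # vs" "\<forall>z\<in>set us. z < m" "\<forall>z\<in>set vs. z < m"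
    using split_list_at_max[OF assms] .
  then obtain ws where ws: "psb_run [m] [] vs = ws @ [m]"
    using psb_run_keeps_stack[of vs m "[]" "[]"] assms(2) by auto
  have P: "PSB xs = (PSB us @ ws) @ [m]"
    using xs ws by (simp add: PSB_append_greater)
  have "\<forall>z\<in>set (PSB us @ ws). z < m"
  proof
    fix z assume z: "z \<in> set (PSB us @ ws)"
    then have "z \<in> set xs" "z \<noteq> m"
      using P set_PSB[of xs] distinct_PSB[of xs] assms(2) by auto
    then show "z < m" using xs by auto
  qed
  with P show thesis by (rule that)
qed

section \<open>Construction of preimages\<close>

text \<open>The arrival of \<open>m\<close> flushes \<open>p\<close>, giving
  \<open>us @ [y]\<close>. Entries of \<open>vs\<close> lie below \<open>y\<close>, hence below
  \<open>m - 1\<close>, and bypass \<open>m\<close>, which is popped last.\<close>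

lemma PSB_insert_max:
  assumes "distinct (us @ y # vs)" "\<forall>z\<in>set (us @ y # vs). z < m" "\<forall>z\<in>set vs. z < y"
    and p: "distinct p" "PSB p = us @ [y]"
  shows "distinct (p @ m # vs)" "PSB (p @ m # vs) = us @ y # vs @ [m]"
proof -
  have sp: "set p = insert y (set us)" using set_PSB[of p] p by auto
  show "distinct (p @ m # vs)" using assms(1,2) p(1) sp by auto
  have "\<forall>z\<in>set p. z < m" "\<forall>z\<in>set vs. z + 1 < m"
    using assms(2,3) sp by fastforce+
  then show "PSB (p @ m # vs) = us @ y # vs @ [m]"
    using p by (simp add: PSB_append_greater psb_run_bypass)
qed

lemma PSB_preimage_exists:
  assumes "distinct xs" "\<forall>z\<in>set xs. z < m"
  shows "\<exists>p. distinct p \<and> PSB p = xs @ [m]"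
  using assms
proof (induction "length xs" arbitrary: xs m rule: less_induct)
  case less
  show ?case
  proof (cases "xs = []")
    case True
    then show ?thesis by (intro exI[of _ "[m]"]) (simp add: PSB_def)
  next
    case False
    obtain us y vs where xs: "xs = us @ y # vs" "\<forall>z\<in>set us. z < y" "\<forall>z\<in>set vs. z < y"
      using split_list_at_max[OF False less.prems(1)] .
    obtain p where p: "distinct p" "PSB p = us @ [y]"
      using less.hyps[of us y] xs less.prems(1) by auto
    have "distinct (p @ m # vs)" "PSB (p @ m # vs) = xs @ [m]"
      using PSB_insert_max[of us y vs m p] xs less.prems p by simp_all
    then show ?thesis by blast
  qed
qed

section \<open>The staircase condition and its recursion\<close>

text \<open>
  For a permutation of \<open>{1..n}\<close> the left-to-right maxima are among the entries \<open>\<ge> hd xs\<close>, so they are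
  consecutive values ending in \<open>n\<close> iff these entries are all of them, that is, iff these entries
  appear in increasing order.
\<close>

definition staircase :: "nat list \<Rightarrow> bool" where
  "staircase xs \<longleftrightarrow> filter (\<lambda>x. hd xs \<le> x) xs = [hd xs..<Suc (last xs)] \<and>
     successively (\<lambda>x y. x < hd xs \<or> y < hd xs) xs"

lemma staircase_singleton: "staircase [m]"
  by (simp add: staircase_def)

text \<open>Cutting at the second largest entry \<open>y\<close> matches the recursion by which
  preimages are built.\<close>

lemma staircase_snoc_iff:
  assumes "distinct (us @ y # vs)" "\<forall>z\<in>set us. z < y" "\<forall>z\<in>set vs. z < y" "y < m"
  shows "staircase (us @ y # vs @ [m]) \<longleftrightarrow> staircase (us @ [y]) \<and> vs \<noteq> [] \<and> m = Suc y"
proof -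
  define f where "f = hd (us @ [y])"
  have hd: "hd (us @ y # zs) = f" for zs unfolding f_def by (cases us) auto
  have fy: "f \<le> y" unfolding f_def using assms(2) by (cases us) auto
  let ?F = "filter (\<lambda>x. f \<le> x)"
  show ?thesis
  proof
    assume L: "staircase (us @ y # vs @ [m])"
    then have F: "?F us @ y # ?F vs @ [m] = [f..<Suc m]"
      and S: "successively (\<lambda>x y. x < f \<or> y < f) (us @ y # vs @ [m])"
      unfolding staircase_def hd using fy assms(4) by auto
    \<comment> \<open>An entry of \<open>vs\<close> that is at least \<open>f\<close> would come
      after \<open>y\<close> in an increasing list although it is smaller than
      \<open>y\<close>.\<close>
    have "sorted_wrt (<) (?F us @ y # ?F vs @ [m])" unfolding F by (simp del: upt_Suc)
    then have "?F vs = []" using assms(3) by (fastforce simp: sorted_wrt_append filter_empty_conv)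
    with F have F': "?F us @ [y] = [f..<m]"
      using fy assms(4) by (simp add: upt_Suc_append)
    then have m: "m = Suc y" using fy assms(4)
      by (cases m) (auto simp: upt_Suc_append)
    moreover have "vs \<noteq> []" using S fy assms(4) by (auto simp: successively_append_iff)
    moreover have "staircase (us @ [y])"
      unfolding staircase_def hd using F' m fy S by (auto simp: successively_append_iff)
    ultimately show "staircase (us @ [y]) \<and> vs \<noteq> [] \<and> m = Suc y" by blast
  next
    assume R: "staircase (us @ [y]) \<and> vs \<noteq> [] \<and> m = Suc y"
    then have F: "?F us @ [y] = [f..<Suc y]"
      and S: "successively (\<lambda>x y. x < f \<or> y < f) (us @ [y])"
      unfolding staircase_def hd using fy by auto
    \<comment> \<open>All values from \<open>f\<close> to \<open>y\<close> already occur in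
      \<open>us @ [y]\<close>, so distinctness leaves only values below \<open>f\<close> for
      \<open>vs\<close>; these separate \<open>y\<close> from \<open>m\<close>.\<close>
    have vs: "z < f" if "z \<in> set vs" for z
    proof (rule ccontr)
      assume "\<not> z < f"
      then have "z \<in> set [f..<Suc y]" using assms(3) that by force
      then have "z \<in> set (us @ [y])" unfolding F[symmetric] by auto
      then show False using assms(1) that by auto
    qed
    have "successively (\<lambda>x y. x < f \<or> y < f) vs"
      using vs by (auto simp: successively_conv_nth)
    moreover have "?F vs = []" using vs by (auto simp: filter_empty_conv not_le)
    ultimately show "staircase (us @ y # vs @ [m])"
      unfolding staircase_def hd using R F S vs fy
      by (auto simp: successively_append_iff successively_Cons)
  qed
qed

section \<open>Uniqueness of preimages\<close>

text \<open>Cut \<open>p\<close> at \<open>Suc y\<close>. Once the part \<open>b\<close> after it is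
  known to bypass, the equation reduces to \<open>PSB a @ b = us @ y # vs\<close>, in which
  \<open>y\<close> can be located.\<close>

lemma PSB_preimage_of_adjacent_max:
  assumes "distinct (us @ y # vs)" "\<forall>z\<in>set us. z < y" "\<forall>z\<in>set vs. z < y" "vs \<noteq> []"
    and p: "distinct p" "PSB p = us @ y # vs @ [Suc y]"
  obtains a where "p = a @ Suc y # vs" "PSB a = us @ [y]"
proof -
  have sp: "set p = insert (Suc y) (set (us @ y # vs))" using set_PSB[of p] p by auto
  then obtain a b where ab: "p = a @ Suc y # b" by (metis insertI1 split_list)
  have lt: "z < Suc y" if "z \<in> set a \<union> set b" for z
  proof -
    have "z \<in> set p" "z \<noteq> Suc y" using that p(1) ab by auto
    then show ?thesis using sp assms(2,3) by auto
  qed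
  then have b: "\<forall>z\<in>set b. z < Suc y" by blast
  have eq: "PSB a @ psb_run [Suc y] [] b = us @ y # vs @ [Suc y]"
    using p(2) ab lt by (simp add: PSB_append_greater)
  \<comment> \<open>If \<open>y\<close> came after \<open>Suc y\<close>, it would be output directly
    before it, whereas the nonempty \<open>vs\<close> stands between them.\<close>
  have yb: "y \<notin> set b"
  proof
    assume "y \<in> set b"
    then obtain ws where "psb_run [Suc y] [] b = ws @ [y, Suc y]"
      using psb_run_pushes_pred[of b y] b p(1) ab by auto
    then have "PSB a @ ws @ [y] = us @ y # vs" using eq by simp
    then have "y = last (us @ y # vs)" by (metis append_assoc last_snoc)
    then have "y \<in> set vs" using assms(4) by simp
    then show False using assms(3) by blast
  qed
  then have "\<forall>z\<in>set b. z + 1 < Suc y" using b by (auto simp: less_Suc_eq)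
  then have eq2: "PSB a @ b = us @ y # vs" using eq by (simp add: psb_run_bypass)
  \<comment> \<open>\<open>PSB a\<close> ends with its maximum. As \<open>y\<close> lies in
    \<open>a\<close> and is maximal in \<open>us @ y # vs\<close>, that last entry is
    \<open>y\<close>, and the two cuts at \<open>y\<close> agree.\<close>
  have ya: "y \<in> set a" using yb eq2 set_PSB[of a]
    by (metis Un_iff in_set_conv_decomp set_append)
  then obtain cs c where c: "PSB a = cs @ [c]" "\<forall>z\<in>set cs. z < c"
    using PSB_ends_with_max[of a] p(1) ab by (metis distinct_append empty_iff empty_set)
  have "c \<in> set (us @ y # vs)" unfolding eq2[symmetric] c by simp
  then have "c \<le> y" using assms(2,3) by auto
  moreover have "y \<in> set (cs @ [c])" using ya set_PSB[of a] c by simp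
  ultimately have "c = y" using c(2) by auto
  then have "cs @ y # b = us @ y # vs" using eq2 c by simp
  moreover have "y \<notin> set us" "y \<notin> set vs" using assms(2,3) by auto
  ultimately have "cs = us \<and> b = vs"
    using append_Cons_eq_iff[of y us vs cs b] by auto
  then show thesis using that ab c(1) \<open>c = y\<close> by blast
qed

text \<open>Appending \<open>m # vs\<close> embeds the preimages of \<open>us @ [y]\<close> into
  those of \<open>xs @ [m]\<close>; the two conditions added by \<open>staircase_snoc_iff\<close>
  say exactly when none is missed.\<close>

lemma unique_PSB_preimage_iff:
  assumes "distinct xs" "\<forall>z\<in>set xs. z < m"
  shows "(\<exists>!p. distinct p \<and> PSB p = xs @ [m]) \<longleftrightarrow> staircase (xs @ [m])"
  using assms
proof (induction "length xs" arbitrary: xs m rule: less_induct)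
  case less
  show ?case
  proof (cases "xs = []")
    case True
    have "p = [m]" if "PSB p = [m]" for p
      using mset_PSB[of p] that by simp
    then have "\<exists>!p. distinct p \<and> PSB p = xs @ [m]"
      using True by (intro ex1I[of _ "[m]"]) (auto simp: PSB_def)
    then show ?thesis using True staircase_singleton by auto
  next
    case False
    obtain us y vs where xs: "xs = us @ y # vs" "\<forall>z\<in>set us. z < y" "\<forall>z\<in>set vs. z < y"
      using split_list_at_max[OF False less.prems(1)] .
    have ym: "y < m" using less.prems xs by auto
    have IH: "(\<exists>!p. distinct p \<and> PSB p = us @ [y]) \<longleftrightarrow> staircase (us @ [y])"
      using less.hyps[of us y] xs less.prems(1) by auto
    have lift: "distinct (p @ m # vs) \<and> PSB (p @ m # vs) = xs @ [m]"
      if "distinct p" "PSB p = us @ [y]" for p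
      using PSB_insert_max[of us y vs m p] xs less.prems that by simp
    obtain q where q: "distinct q" "PSB q = us @ [y]"
      using PSB_preimage_exists[of us y] less.prems(1) xs by auto
    have stair: "staircase (xs @ [m]) \<longleftrightarrow> staircase (us @ [y]) \<and> vs \<noteq> [] \<and> m = Suc y"
      using staircase_snoc_iff[of us y vs m] xs less.prems(1) ym by simp
    show ?thesis
    proof
      assume U: "\<exists>!p. distinct p \<and> PSB p = xs @ [m]"
      \<comment> \<open>The preimage obtained from \<open>q\<close> does not begin with
        \<open>m\<close>, so by uniqueness \<open>m # xs\<close> cannot be a preimage.\<close>
      have "hd (q @ m # vs) \<noteq> m"
      proof -
        have "q \<noteq> []" using q by (auto simp: PSB_def)
        moreover have "m \<notin> set q" using set_PSB[of q] q less.prems(2) xs(1) by auto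
        ultimately show ?thesis by (metis hd_append2 hd_in_set)
      qed
      moreover have "distinct (m # xs)" using less.prems by auto
      ultimately have no: "PSB (m # xs) \<noteq> xs @ [m]"
        using U lift[OF q] by (metis list.sel(1))
      have m: "m = Suc y"
      proof (rule ccontr)
        assume "m \<noteq> Suc y"
        then have "\<forall>x\<in>set xs. x + 1 < m" using ym xs by auto
        then show False using no by (simp add: PSB_def psb_run_bypass)
      qed
      have "vs \<noteq> []"
      proof
        assume "vs = []"
        \<comment> \<open>\<open>us\<close> bypasses \<open>m\<close>, then \<open>y = m - 1\<close>
          is pushed on it, and the final pop yields \<open>y\<close>, \<open>m\<close>.\<close>
        then have "PSB (m # xs) = xs @ [m]"
          using xs m by (simp add: PSB_def psb_run_bypass_append)
        with no show False ..
      qed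
      \<comment> \<open>Appending \<open>m # vs\<close> is injective, so uniqueness descends to
        \<open>us @ [y]\<close>.\<close>
      moreover have "\<exists>!p. distinct p \<and> PSB p = us @ [y]"
        using U lift q by (metis append_same_eq)
      ultimately show "staircase (xs @ [m])" using stair IH m by blast
    next
      assume "staircase (xs @ [m])"
      then have uniq: "\<exists>!p. distinct p \<and> PSB p = us @ [y]" and vs: "vs \<noteq> []" and m: "m = Suc y"
        using stair IH by blast+
      have "p = q @ m # vs" if p: "distinct p" "PSB p = xs @ [m]" for p
      proof -
        obtain a where a: "p = a @ m # vs" "PSB a = us @ [y]"
          using PSB_preimage_of_adjacent_max[of us y vs p] less.prems(1) xs p vs m by auto
        then have "distinct a" using p(1) by simp
        then show ?thesis using uniq a q by blast
      qed
      then show "\<exists>!p. distinct p \<and> PSB p = xs @ [m]" using lift[OF q] by blast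
    qed
  qed
qed

section \<open>Left-to-right maxima and the characterisation of \<open>C1\<close>\<close>

lemma LTR_snoc: "LTR (xs @ [x]) = LTR xs \<union> (if \<forall>y\<in>set xs. y < x then {x} else {})"
proof -
  have nth: "(xs @ [x]) ! i = (if i < length xs then xs ! i else x)" if "i \<le> length xs" for i
    using that by (auto simp: nth_append)
  have "z \<in> LTR (xs @ [x]) \<longleftrightarrow> z \<in> LTR xs \<or> (z = x \<and> (\<forall>y\<in>set xs. y < x))" for z
  proof -
    have "z \<in> LTR (xs @ [x]) \<longleftrightarrow>
        (\<exists>i<Suc (length xs). z = (xs @ [x]) ! i \<and> (\<forall>j<i. (xs @ [x]) ! j < (xs @ [x]) ! i))"
      by (auto simp: LTR_def)
    also have "\<dots> \<longleftrightarrow> (\<exists>i<length xs. z = xs ! i \<and> (\<forall>j<i. xs ! j < xs ! i)) \<or>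
        (z = x \<and> (\<forall>j<length xs. xs ! j < x))"
      unfolding Ex_less_Suc by (simp add: nth cong: conj_cong) blast
    finally show ?thesis by (auto simp: LTR_def all_set_conv_all_nth)
  qed
  then show ?thesis by auto
qed

lemma LTR_subset: "LTR xs \<subseteq> set xs"
  by (auto simp: LTR_def)

lemma hd_in_LTR: "xs \<noteq> [] \<Longrightarrow> hd xs \<in> LTR xs"
  by (auto simp: LTR_def hd_conv_nth intro!: exI[of _ 0])

lemma hd_le_LTR:
  assumes "x \<in> LTR xs"
  shows "hd xs \<le> x"
proof -
  obtain i where i: "i < length xs" "\<forall>j<i. xs ! j < xs ! i" "x = xs ! i"
    using assms by (auto simp: LTR_def)
  then have "hd xs = xs ! 0" by (intro hd_conv_nth) auto
  with i show ?thesis by (cases "i = 0") (auto intro: less_imp_le)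
qed

text \<open>An entry \<open>\<ge> f\<close> fails to be a left-to-right maximum only because of a
  larger earlier entry, which is then \<open>\<ge> f\<close> too and forms an inversion in the
  filtered list.\<close>

lemma filter_ge_sorted_iff:
  assumes "distinct xs"
  shows "sorted_wrt (<) (filter (\<lambda>x. f \<le> x) xs) \<longleftrightarrow> {x \<in> set xs. f \<le> x} \<subseteq> LTR xs"
  using assms
proof (induction xs rule: rev_induct)
  case (snoc x xs)
  have x: "x \<notin> LTR xs" "x \<notin> set xs" using snoc.prems LTR_subset[of xs] by auto
  have "(\<forall>y\<in>set xs. y < x) \<longleftrightarrow> (\<forall>y\<in>set xs. f \<le> y \<longrightarrow> y < x)" if "f \<le> x"
    using that by (meson le_less_linear less_le_trans)
  with x snoc show ?case
    unfolding LTR_snoc by (auto simp: sorted_wrt_append)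
qed simp

lemma permsD:
  assumes "xs \<in> perms n"
  shows "distinct xs" "set xs = {1..n}" "length xs = n"
  using assms by (auto simp: perms_def permutations_of_set_def dest: distinct_card)

lemma permsI: "distinct xs \<Longrightarrow> set xs = {1..n} \<Longrightarrow> xs \<in> perms n"
  by (simp add: perms_def permutations_of_set_def)

lemma staircase_perms_iff:
  assumes "xs \<in> perms n" "n > 0"
  shows "staircase xs \<longleftrightarrow>
    last xs = n \<and> (\<exists>k. LTR xs = {n - k..n}) \<and>
    (\<forall>i<n. \<forall>j<n. xs ! i \<in> LTR xs \<and> xs ! j \<in> LTR xs \<and> xs ! i \<noteq> xs ! j \<longrightarrow>
       \<bar>int j - int i\<bar> > 1)"
    (is "_ \<longleftrightarrow> _ \<and> _ \<and> ?N")
proof -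
  note xs = permsD[OF assms(1)]
  define f where "f = hd xs"
  have ne: "xs \<noteq> []" using xs assms(2) by auto
  then have "f \<in> set xs" by (simp add: f_def)
  then have f: "1 \<le> f" "f \<le> n" using xs by auto
  \<comment> \<open>Once \<open>LTR xs\<close> is \<open>{f..n}\<close>, being a left-to-right
    maximum just means being at least \<open>f\<close>, so nonadjacency can be tested on
    neighbours.\<close>
  have suc: "?N \<longleftrightarrow> successively (\<lambda>x y. x < f \<or> y < f) xs" if L: "LTR xs = {f..n}"
  proof -
    have mem: "xs ! i \<in> LTR xs \<longleftrightarrow> \<not> xs ! i < f" if "i < n" for i
      using that xs nth_mem[of i xs] unfolding L by auto
    show ?thesis
    proof
      assume N: ?N
      have "xs ! i < f \<or> xs ! Suc i < f" if i: "Suc i < n" for i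
      proof (rule ccontr)
        assume "\<not> ?thesis"
        then have "xs ! i \<in> LTR xs" "xs ! Suc i \<in> LTR xs" using mem i by auto
        moreover have "xs ! i \<noteq> xs ! Suc i" using xs i by (simp add: nth_eq_iff_index_eq)
        moreover have "i < n" using i by simp
        ultimately have "\<bar>int (Suc i) - int i\<bar> > 1" using N i by blast
        then show False by simp
      qed
      then show "successively (\<lambda>x y. x < f \<or> y < f) xs"
        using xs(3) by (auto simp: successively_conv_nth)
    next
      assume S: "successively (\<lambda>x y. x < f \<or> y < f) xs"
      show ?N
      proof (intro allI impI)
        fix i j
        assume ij: "i < n" "j < n" "xs ! i \<in> LTR xs \<and> xs ! j \<in> LTR xs \<and> xs ! i \<noteq> xs ! j"
        then have "\<not> xs ! i < f" "\<not> xs ! j < f" "i \<noteq> j" using mem by auto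
        then have "j \<noteq> Suc i" "i \<noteq> Suc j"
          using S ij(1,2) xs(3) by (auto simp: successively_conv_nth)
        with \<open>i \<noteq> j\<close> show "\<bar>int j - int i\<bar> > 1" by linarith
      qed
    qed
  qed
  have LTR_sub: "LTR xs \<subseteq> {f..n}"
  proof
    fix x assume "x \<in> LTR xs"
    then show "x \<in> {f..n}" using LTR_subset[of xs] hd_le_LTR[of x xs] xs(2) by (auto simp: f_def)
  qed
  have ge: "{x \<in> set xs. f \<le> x} = {f..n}" using xs f by auto
  show ?thesis
  proof
    assume st: "staircase xs"
    then have F: "filter (\<lambda>x. f \<le> x) xs = [f..<Suc (last xs)]"
      and S: "successively (\<lambda>x y. x < f \<or> y < f) xs" by (simp_all add: staircase_def f_def)
    have "n \<in> set [f..<Suc (last xs)]" unfolding F[symmetric] using f xs by auto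
    moreover have "last xs \<le> n" using xs last_in_set[OF ne] by auto
    ultimately have last: "last xs = n" by auto
    have "{f..n} \<subseteq> LTR xs"
      using filter_ge_sorted_iff[OF xs(1), of f] F ge by (simp del: upt_Suc)
    then have L: "LTR xs = {f..n}" using LTR_sub by blast
    then have "LTR xs = {n - (n - f)..n}" using f by simp
    then have "\<exists>k. LTR xs = {n - k..n}" ..
    moreover have ?N using suc[OF L] S by (rule iffD2)
    ultimately show "last xs = n \<and> (\<exists>k. LTR xs = {n - k..n}) \<and> ?N" using last by (intro conjI)
  next
    assume R: "last xs = n \<and> (\<exists>k. LTR xs = {n - k..n}) \<and> ?N"
    then obtain k where k: "LTR xs = {n - k..n}" by (elim conjE exE)
    \<comment> \<open>The two memberships give the two inequalities between \<open>f\<close> and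
      \<open>n - k\<close>. As \<open>f \<ge> 1\<close>, a truncated difference
      \<open>n - k = 0\<close> is ruled out as well.\<close>
    have "f \<in> {n - k..n}" using hd_in_LTR[OF ne] k by (simp add: f_def)
    moreover have "n - k \<in> {f..n}" using LTR_sub unfolding k by auto
    ultimately have "n - k = f" by simp
    with k have L: "LTR xs = {f..n}" by simp
    have "sorted_wrt (<) (filter (\<lambda>x. f \<le> x) xs)"
      using filter_ge_sorted_iff[OF xs(1), of f] ge L by simp
    moreover have "set (filter (\<lambda>x. f \<le> x) xs) = set [f..<Suc n]"
      using ge by (simp only: set_filter set_upt atLeastLessThanSuc_atLeastAtMost)
    ultimately have "filter (\<lambda>x. f \<le> x) xs = [f..<Suc n]"
      using strict_sorted_equal sorted_wrt_upt by blast
    moreover have "successively (\<lambda>x y. x < f \<or> y < f) xs"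
      by (rule iffD1[OF suc[OF L]]) (use R in \<open>elim conjE\<close>)
    ultimately show "staircase xs"
      using R by (simp only: staircase_def f_def)
  qed
qed

text \<open>If \<open>s\<close> ends with \<open>n\<close>, this is
  \<open>unique_PSB_preimage_iff\<close>. Otherwise \<open>s\<close> has no preimage at all, since
  outputs end with their maximum, and it is no staircase either.\<close>

lemma C1_iff_staircase:
  assumes "n > 0"
  shows "C1 n = {s \<in> perms n. staircase s}"
proof -
  have "card (PSB_preimage n s) = 1 \<longleftrightarrow> staircase s" if s: "s \<in> perms n" for s
  proof -
    note sD = permsD[OF s]
    have ne: "s \<noteq> []" using sD assms by auto
    have "p \<in> perms n \<longleftrightarrow> distinct p" if "PSB p = s" for p
      using that sD(2) set_PSB[of p] by (auto intro: permsI dest: permsD(1))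
    then have pre: "PSB_preimage n s = {p. distinct p \<and> PSB p = s}"
      unfolding PSB_preimage_def by blast
    have "{p. distinct p \<and> PSB p = s} = {x} \<longleftrightarrow>
        (distinct x \<and> PSB x = s) \<and> (\<forall>p. distinct p \<and> PSB p = s \<longrightarrow> p = x)" for x
      by blast
    then have one: "card (PSB_preimage n s) = 1 \<longleftrightarrow> (\<exists>!p. distinct p \<and> PSB p = s)"
      unfolding pre One_nat_def card_1_singleton_iff Ex1_def by simp
    show ?thesis
    proof (cases "last s = n")
      case True
      then have s': "s = butlast s @ [n]" using ne by (metis append_butlast_last_id)
      have d: "distinct (butlast s @ [n])" using sD(1) s' by simp
      have "\<forall>z\<in>set (butlast s). z < n"
      proof
        fix z assume z: "z \<in> set (butlast s)"
        then have "z \<noteq> n" using d by auto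
        moreover have "z \<le> n" using sD(2) in_set_butlastD[OF z] by auto
        ultimately show "z < n" by simp
      qed
      then show ?thesis using unique_PSB_preimage_iff[of "butlast s" n] sD(1) one
        unfolding s'[symmetric] by (simp add: distinct_butlast)
    next
      case False
      have "\<not> (distinct p \<and> PSB p = s)" for p
      proof
        assume p: "distinct p \<and> PSB p = s"
        then have "p \<noteq> []" using ne by (auto simp: PSB_def)
        then obtain ys m where "s = ys @ [m]" "\<forall>z\<in>set ys. z < m"
          using PSB_ends_with_max p by metis
        moreover have "n \<in> set s" "last s \<le> n" using sD assms ne last_in_set[OF ne] by auto
        ultimately show False using False by auto
      qed
      moreover have "\<not> staircase s" using staircase_perms_iff[OF s assms] False by blast
      ultimately show ?thesis using one by blast
    qed
  qed
  then show ?thesis by (auto simp: C1_def)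
qed

section \<open>Inserting large entries into gaps\<close>

text \<open>Models what follows the first entry \<open>f\<close> of a staircase:
  \<open>hd xs < f\<close> keeps \<open>f\<close> isolated, and \<open>f \<le> last xs\<close> puts
  \<open>n\<close> at the end. The least large entry \<open>m\<close> is a parameter so that a
  recursion along \<open>r\<close> can use up the large entries one by one.\<close>

definition gap_inserts :: "nat \<Rightarrow> nat \<Rightarrow> nat \<Rightarrow> nat list \<Rightarrow> nat list set" where
  "gap_inserts f n m r = {xs. filter (\<lambda>x. x < f) xs = r \<and> filter (\<lambda>x. f \<le> x) xs = [m..<Suc n] \<and>
     successively (\<lambda>x y. x < f \<or> y < f) xs \<and> hd xs < f \<and> f \<le> last xs}"

lemma gap_inserts_empty: "r \<noteq> [] \<Longrightarrow> gap_inserts f n (Suc n) r = {}"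
proof -
  assume r: "r \<noteq> []"
  have False if "xs \<in> gap_inserts f n (Suc n) r" for xs
  proof -
    have xs: "filter (\<lambda>x. x < f) xs = r" "filter (\<lambda>x. f \<le> x) xs = []" "f \<le> last xs"
      using that by (auto simp: gap_inserts_def)
    then have "last xs \<in> set xs" using r by (intro last_in_set) auto
    then show False using xs(2,3) by (auto simp: filter_empty_conv)
  qed
  then show ?thesis by blast
qed

text \<open>Large entries may not be adjacent, so only one of them fits after a single small
  entry.\<close>

lemma gap_inserts_singleton:
  assumes "x < f" "f \<le> m" "m \<le> n"
  shows "gap_inserts f n m [x] = (if m = n then {[x, n]} else {})"
proof -
  have "gap_inserts f n m [x] \<subseteq> (if m = n then {[x, n]} else {})"
  proof
    fix xs assume "xs \<in> gap_inserts f n m [x]"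
    note D = this[unfolded gap_inserts_def mem_Collect_eq]
    then obtain y t where xs: "xs = y # t" by (cases xs) auto
    then have y: "y = x" and t: "filter (\<lambda>x. x < f) t = []" using D by auto
    have "filter (\<lambda>x. f \<le> x) t = t" using t by (auto simp: filter_empty_conv filter_id_conv)
    then have tm: "t = m # [Suc m..<Suc n]"
      using D xs y assms upt_conv_Cons[of m "Suc n"] by auto
    have "m = n"
    proof (rule ccontr)
      assume "m \<noteq> n"
      then have "t = m # Suc m # [Suc (Suc m)..<Suc n]"
        using tm assms(3) upt_conv_Cons[of "Suc m" "Suc n"] by auto
      then show False using D xs assms by auto
    qed
    then show "xs \<in> (if m = n then {[x, n]} else {})" using tm xs y by auto
  qed
  moreover have "[x, n] \<in> gap_inserts f n n [x]"
    using assms by (auto simp: gap_inserts_def)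
  ultimately show ?thesis by (cases "m = n") (simp_all add: subset_antisym)
qed

text \<open>The gap after \<open>x\<close> either stays empty or receives \<open>m\<close>, the next
  large entry; these are the two terms of Pascal's rule.\<close>

lemma gap_inserts_Cons:
  assumes "x < f" "f \<le> m" "m \<le> n" "r \<noteq> []"
  shows "gap_inserts f n m (x # r) =
    (#) x ` gap_inserts f n m r \<union> (\<lambda>u. x # m # u) ` gap_inserts f n (Suc m) r"
    (is "?L = ?A \<union> ?B")
proof
  show "?L \<subseteq> ?A \<union> ?B"
  proof
    fix xs assume "xs \<in> ?L"
    note D = this[unfolded gap_inserts_def mem_Collect_eq]
    then obtain y t where xs: "xs = y # t" by (cases xs) auto
    then have y: "y = x" and t: "filter (\<lambda>x. x < f) t = r" using D by auto
    then have "t \<noteq> []" using assms(4) by auto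
    then obtain z u where z: "t = z # u" by (cases t) auto
    show "xs \<in> ?A \<union> ?B"
    proof (cases "z < f")
      case True
      then have "t \<in> gap_inserts f n m r"
        using D xs y t z assms by (auto simp: gap_inserts_def)
      then show ?thesis using xs y by auto
    next
      case False
      then have "z # filter (\<lambda>x. f \<le> x) u = m # [Suc m..<Suc n]"
        using D xs y z assms upt_conv_Cons[of m "Suc n"] by auto
      then have zm: "z = m" "filter (\<lambda>x. f \<le> x) u = [Suc m..<Suc n]" by auto
      have u: "filter (\<lambda>x. x < f) u = r" using t z False by simp
      then have "u \<noteq> []" using assms(4) by auto
      then have "u \<in> gap_inserts f n (Suc m) r"
        using D xs y z u zm False by (cases u) (auto simp: gap_inserts_def)
      then show ?thesis using xs y z zm by auto
    qed
  qed
next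
  have ne: "u \<noteq> []" if "u \<in> gap_inserts f n k r" for u k
    using that assms(4) by (auto simp: gap_inserts_def)
  have "x # u \<in> ?L" if "u \<in> gap_inserts f n m r" for u
    using that assms ne[OF that] by (auto simp: gap_inserts_def successively_Cons)
  moreover have "x # m # u \<in> ?L" if "u \<in> gap_inserts f n (Suc m) r" for u
    using that assms ne[OF that] upt_conv_Cons[of m "Suc n"]
    by (auto simp: gap_inserts_def successively_Cons)
  ultimately show "?A \<union> ?B \<subseteq> ?L" by blast
qed

text \<open>The entry \<open>n\<close> is fixed at the end; the other \<open>n - m\<close> large
  entries choose distinct gaps among the \<open>length r - 1\<close> inner ones, and their order is
  forced.\<close>

lemma card_gap_inserts:
  assumes "r \<noteq> []" "\<forall>x\<in>set r. x < f" "f \<le> m" "m \<le> n"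
  shows "finite (gap_inserts f n m r) \<and>
    card (gap_inserts f n m r) = (length r - 1) choose (n - m)"
  using assms
proof (induction r arbitrary: m rule: list_nonempty_induct)
  case (single x)
  then show ?case by (auto simp: gap_inserts_singleton)
next
  case (cons x r)
  let ?A = "gap_inserts f n m r" and ?B = "gap_inserts f n (Suc m) r"
  have A: "finite ?A" "card ?A = (length r - 1) choose (n - m)" using cons by auto
  have B: "finite ?B" "card ?B = (if m = n then 0 else (length r - 1) choose (n - Suc m))"
    using cons.IH[of "Suc m"] cons.hyps cons.prems
    by (cases "m = n"; simp add: gap_inserts_empty)+
  have disj: "(#) x ` ?A \<inter> (\<lambda>u. x # m # u) ` ?B = {}"
  proof -
    have "hd u < f" if "u \<in> ?A" for u using that by (simp add: gap_inserts_def)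
    then show ?thesis using cons.prems(2) by fastforce
  qed
  have "card (gap_inserts f n m (x # r)) = card ?A + card ?B"
    using cons A(1) B(1) disj
    by (simp add: gap_inserts_Cons card_Un_disjoint card_image inj_on_def)
  also have "\<dots> = length r choose (n - m)"
  proof (cases "m = n")
    case True
    then show ?thesis using A B by simp
  next
    case False
    obtain l where l: "length r = Suc l" using cons.hyps by (cases r) auto
    obtain d where d: "n - m = Suc d" using False cons.prems by (metis Suc_diff_Suc le_neq_implies_less)
    then have "n - Suc m = d" by simp
    then show ?thesis using A B False l d by simp
  qed
  finally show ?case using cons A(1) B(1) by (simp add: gap_inserts_Cons)
qed

section \<open>Counting by the first entry\<close>

lemma staircase_hd_bounds:
  assumes "s \<in> perms n" "n \<ge> 2" "staircase s"
  shows "1 < hd s" "hd s < n"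
proof -
  note s = permsD[OF assms(1)]
  obtain x y t where xyt: "s = x # y # t" using s(3) assms(2)
    by (metis Suc_le_length_iff numeral_2_eq_2)
  have "y < x" "x \<le> n" "1 \<le> y" "y \<le> n" using assms(3) xyt s(2) by (auto simp: staircase_def)
  then show "1 < hd s" using xyt by simp
  show "hd s < n"
  proof (rule ccontr)
    assume "\<not> hd s < n"
    then have x: "x = n" using xyt \<open>x \<le> n\<close> by simp
    have "last s = n" using staircase_perms_iff[OF assms(1)] assms(2,3) by auto
    moreover have "last s \<in> set (y # t)" using xyt by simp
    ultimately show False using x xyt s(1) by auto
  qed
qed

lemma staircase_perms_tail:
  assumes "t \<in> gap_inserts f n (Suc f) r" "r \<in> permutations_of_set {1..<f}" "1 < f" "f < n"
  shows "f # t \<in> perms n" "staircase (f # t)"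
proof -
  note D = assms(1)[unfolded gap_inserts_def mem_Collect_eq]
  have r: "distinct r" "set r = {1..<f}" using assms(2) by (auto simp: permutations_of_set_def)
  then have "t \<noteq> []" using D assms(3) by auto
  \<comment> \<open>Small and large entries together exhaust \<open>t\<close>, which yields both its
    set and its distinctness.\<close>
  have "mset t = mset (filter (\<lambda>x. x < f) t) + mset (filter (\<lambda>x. f \<le> x) t)"
    unfolding not_less[symmetric] mset_filter by (rule multiset_partition)
  then have mt: "mset t = mset (r @ [Suc f..<Suc n])" using D by simp
  have st: "set t = {1..<f} \<union> {Suc f..<Suc n}"
    using mset_eq_setD[OF mt] r by (simp del: upt_Suc)
  have "distinct (r @ [Suc f..<Suc n])" using r by auto
  then have "distinct t" by (rule iffD2[OF mset_eq_imp_distinct_iff[OF mt]])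
  then have "distinct (f # t)" using st by simp
  moreover have "insert f ({1..<f} \<union> {Suc f..<Suc n}) = {1..n}" using assms(3,4) by auto
  then have "set (f # t) = {1..n}" using st by simp
  ultimately show "f # t \<in> perms n" by (rule permsI)
  obtain u z where u: "t = u @ [z]" using \<open>t \<noteq> []\<close> by (cases t rule: rev_cases) auto
  then have "f \<le> z" using D by simp
  \<comment> \<open>The large entries of \<open>t\<close> end with \<open>n\<close>, and
    \<open>t\<close> ends with a large entry, so comparing last elements gives
    \<open>last t = n\<close>.\<close>
  then have "[Suc f..<n] @ [n] = filter (\<lambda>x. f \<le> x) u @ [z]" using D u assms(3,4) by auto
  then have "last t = n" using u by simp
  then show "staircase (f # t)"
    using D \<open>t \<noteq> []\<close> assms(3,4) upt_conv_Cons[of f "Suc n"]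
    by (auto simp: staircase_def successively_Cons simp del: upt_Suc)
qed

lemma staircase_perms_tail_in_gap_inserts:
  assumes "f # t \<in> perms n" "staircase (f # t)" "1 < f" "f < n"
  shows "filter (\<lambda>x. x < f) t \<in> permutations_of_set {1..<f}"
    and "t \<in> gap_inserts f n (Suc f) (filter (\<lambda>x. x < f) t)"
proof -
  note p = permsD[OF assms(1)]
  have last: "last (f # t) = n" using staircase_perms_iff[OF assms(1)] assms(2-4) by auto
  then have "t \<noteq> []" using assms(4) by auto
  have "set (filter (\<lambda>x. x < f) t) = {x \<in> set (f # t). x < f}" by auto
  also have "\<dots> = {1..<f}" unfolding p(2) using assms(4) by auto
  finally show "filter (\<lambda>x. x < f) t \<in> permutations_of_set {1..<f}"
    using p(1) unfolding permutations_of_set_def by simp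
  show "t \<in> gap_inserts f n (Suc f) (filter (\<lambda>x. x < f) t)"
    using assms(2-4) last \<open>t \<noteq> []\<close> upt_conv_Cons[of f "Suc n"]
    by (auto simp: gap_inserts_def staircase_def successively_Cons simp del: upt_Suc)
qed

lemma staircase_perms_hd_eq:
  assumes "1 < f" "f < n"
  shows "{s \<in> perms n. staircase s \<and> hd s = f} =
    (#) f ` (\<Union>r\<in>permutations_of_set {1..<f}. gap_inserts f n (Suc f) r)" (is "?L = ?R")
proof
  show "?L \<subseteq> ?R"
  proof
    fix s assume s: "s \<in> ?L"
    then have "s \<noteq> []" using assms by (auto dest: permsD(3))
    then obtain t where t: "s = f # t" using s by (cases s) auto
    have "f # t \<in> perms n" "staircase (f # t)" using s t by auto
    from staircase_perms_tail_in_gap_inserts[OF this assms] show "s \<in> ?R"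
      unfolding t by blast
  qed
  show "?R \<subseteq> ?L" using staircase_perms_tail[OF _ _ assms] by auto
qed

text \<open>The factorial counts the orders \<open>r\<close> of the entries below \<open>f\<close>,
  and the binomial the placements of \<open>f + 1, ..., n - 1\<close> in the \<open>f - 2\<close>
  inner gaps. The classes are disjoint because filtering recovers \<open>r\<close>.\<close>

lemma card_staircase_hd:
  assumes "1 < f" "f < n"
  shows "card {s \<in> perms n. staircase s \<and> hd s = f} = fact (f - 1) * ((f - 2) choose (n - Suc f))"
proof -
  let ?R = "permutations_of_set {1..<f}"
  let ?G = "gap_inserts f n (Suc f)"
  have G: "finite (?G r) \<and> card (?G r) = (f - 2) choose (n - Suc f)" if "r \<in> ?R" for r
  proof -
    have "set r = {1..<f}" "length r = f - 1"
      using that by (auto simp: permutations_of_set_def simp flip: distinct_card)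
    then have "r \<noteq> []" "\<forall>x\<in>set r. x < f" "length r - 1 = f - 2" using assms by auto
    then show ?thesis using card_gap_inserts[of r f "Suc f" n] assms(2) by simp
  qed
  have "card {s \<in> perms n. staircase s \<and> hd s = f} = card (\<Union>r\<in>?R. ?G r)"
    unfolding staircase_perms_hd_eq[OF assms] by (simp add: card_image)
  also have "\<dots> = (\<Sum>r\<in>?R. card (?G r))"
  proof (rule card_UN_disjoint)
    show "\<forall>r\<in>?R. \<forall>r'\<in>?R. r \<noteq> r' \<longrightarrow> ?G r \<inter> ?G r' = {}"
      unfolding gap_inserts_def by blast
  qed (use G in auto)
  also have "\<dots> = fact (f - 1) * ((f - 2) choose (n - Suc f))"
    using G by simp
  finally show ?thesis .
qed

lemma card_staircase:
  assumes "n \<ge> 2"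
  shows "card {s \<in> perms n. staircase s} =
    (\<Sum>k = 2..n - 1. fact (n - k) * ((n - k - 1) choose (k - 2)))"
proof -
  let ?S = "\<lambda>f. {s \<in> perms n. staircase s \<and> hd s = f}"
  have "{s \<in> perms n. staircase s} = (\<Union>f\<in>{2..n - 1}. ?S f)"
    using staircase_hd_bounds[OF _ assms] by fastforce
  moreover have fin: "finite (?S f)" for f
    by (rule finite_subset[of _ "perms n"]) (auto simp: perms_def)
  moreover have "card (\<Union>f\<in>{2..n - 1}. ?S f) = (\<Sum>f = 2..n - 1. card (?S f))"
    by (rule card_UN_disjoint) (use fin in auto)
  ultimately have "card {s \<in> perms n. staircase s} = (\<Sum>f = 2..n - 1. card (?S f))"
    by (simp only:)
  also have "\<dots> = (\<Sum>f = 2..n - 1. fact (f - 1) * ((f - 2) choose (n - Suc f)))"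
    by (rule sum.cong) (auto simp: card_staircase_hd)
  \<comment> \<open>The substitution \<open>k = n + 1 - f\<close> turns the first entry into the
    number of left-to-right maxima \<open>f, ..., n\<close>.\<close>
  also have "\<dots> = (\<Sum>k = 2..n - 1. fact (n - k) * ((n - k - 1) choose (k - 2)))"
    by (rule sum.reindex_bij_witness[of _ "\<lambda>k. Suc n - k" "\<lambda>f. Suc n - f"])
      (auto simp: numeral_2_eq_2)
  finally show ?thesis .
qed

theorem proposition3p2:
  fixes n :: nat
  assumes "n \<ge> 3"
  shows "C1 n = {\<pi> \<in> perms n.
            \<pi> ! (n - 1) = n \<and>
            (\<exists>k::nat. LTR \<pi> = {n - k..n}) \<and>
            (\<forall>i<n. \<forall>j<n. \<pi> ! i \<in> LTR \<pi> \<and> \<pi> ! j \<in> LTR \<pi> \<and> \<pi> ! i \<noteq> \<pi> ! j \<longrightarrow>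
               \<bar>int j - int i\<bar> > 1)}
       \<and> c1 n = (\<Sum>k = 2..nat \<lceil>real n / 2\<rceil>. fact (n - k) * ((n - k - 1) choose (k - 2)))"
proof
  have C: "C1 n = {s \<in> perms n. staircase s}" using C1_iff_staircase assms by simp
  have last: "last s = s ! (n - 1)" if "s \<in> perms n" for s
    using permsD(3)[OF that] assms by (subst last_conv_nth) auto
  show "C1 n = {\<pi> \<in> perms n.
            \<pi> ! (n - 1) = n \<and>
            (\<exists>k::nat. LTR \<pi> = {n - k..n}) \<and>
            (\<forall>i<n. \<forall>j<n. \<pi> ! i \<in> LTR \<pi> \<and> \<pi> ! j \<in> LTR \<pi> \<and> \<pi> ! i \<noteq> \<pi> ! j \<longrightarrow>
               \<bar>int j - int i\<bar> > 1)}"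
    unfolding C using staircase_perms_iff last assms by (intro Collect_cong conj_cong) auto
  have ceil: "nat \<lceil>real n / 2\<rceil> = (n + 1) div 2" by linarith
  have "c1 n = (\<Sum>k = 2..n - 1. fact (n - k) * ((n - k - 1) choose (k - 2)))"
    using card_staircase assms by (simp add: c1_def C)
  \<comment> \<open>For \<open>k > (n + 1) div 2\<close> the binomial vanishes, since then
    \<open>k - 2 > n - k - 1\<close>; \<open>n \<ge> 3\<close> ensures
    \<open>(n + 1) div 2 \<le> n - 1\<close>.\<close>
  also have "\<dots> = (\<Sum>k = 2..(n + 1) div 2. fact (n - k) * ((n - k - 1) choose (k - 2)))"
    by (rule sum.mono_neutral_right) (use assms in auto)
  finally show "c1 n = (\<Sum>k = 2..nat \<lceil>real n / 2\<rceil>. fact (n - k) * ((n - k - 1) choose (k - 2)))"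
    unfolding ceil .
qed

end
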